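(* Let $\{Z_n\}_{n\ge 0}$ be a branching process in an i.i.d. random environment, with $X=\ln m_0$, $\mu=\mathbb{E}X$, $\sigma^2=\mathbb{E}(X-\mu)^2$ as in the context, such that almost surely every individual has at least one child and $0<\sigma^2<\infty$. Assume that there exists a constant $H>0$ such that $$\mathbb{E}(X-\mu)^k\le\tfrac12\,k!\,H^{k-2}\,\mathbb{E}(X-\mu)^2\qquad\text{for all integers }k\ge3.$$ Let $n_0\ge0$ and $n\ge1$ be integers, let $\delta_n\in(0,1)$ and $$\Delta_n=\frac{6(1+H)}{n}\ln(2/\delta_n)+\sqrt{\frac{36(1+H)^2}{n^2}\ln^2(2/\delta_n)+\frac2n\sigma^2\ln(2/\delta_n)}.$$ Then $[A_n,+\infty)$, with $$A_n=\frac1n\ln\left(\frac{Z_{n_0+n}}{Z_{n_0}}\right)-\Delta_n,$$ is a $1-\delta_n$ confidence interval for $\mu$, i.e. $\mathbb{P}(\mu\ge A_n)\ge1-\delta_n$.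
   Context: Branching process in a random environment: $\xi=(\xi_0,\xi_1,\dots)$ is a sequence of i.i.d. random variables (the environment). Each value of $\xi_n$ determines a probability distribution $p(\xi_n)=\{p_n(i): i\in\mathbb{N}\}$ on $\mathbb{N}=\{0,1,2,\dots\}$ (the offspring law at generation $n$). The process is defined by $Z_0=1$ and $Z_{n+1}=\sum_{i=1}^{Z_n}N_{n,i}$ for $n\ge 0$, where, conditionally on $\xi$, the variables $\{N_{n,i}: n\ge0,i\ge1\}$ are independent and, for each $n$, the $N_{n,i}$ $(i\ge1)$ have common law $p(\xi_n)$. $\mathbb{P}$ is the total (annealed) law, i.e. $\mathbb{P}(dx,d\xi)=\mathbb{P}_\xi(dx)\tau(d\xi)$ with $\mathbb{P}_\xi$ the conditional law given $\xi$ and $\tau$ the law of $\xi$; $\mathbb{E}$ is the corresponding expectation. Put $m_n=\sum_{i\ge0} i\,p_n(i)$ (conditional mean offspring number at generation $n$ given $\xi$), $X=\ln m_0$, $\mu=\mathbb{E}X$, $\sigma^2=\mathbb{E}(X-\mu)^2$, $\sigma>0$. Standing assumption: $p_0(0)=0$ almost surely (the probability of having no children is zero) and $0<\sigma^2<\infty$; hence $Z_n\ge1$ a.s. for all $n$. *)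

theory Defs
  imports "HOL-Probability.Probability"
begin

(* The mean is taken in [0,\<infinity>], so that an infinite mean is visible as \<top>
   instead of being turned into a default value. *)
definition offspring_mean :: "nat pmf \<Rightarrow> ennreal" where
  "offspring_mean q = (\<Sum>i. of_nat i * ennreal (pmf q i))"

(* The pairs (n, i) with n \<ge> 0 and i \<ge> 1: individual i of generation n. *)
definition individuals :: "(nat \<times> nat) set" where
  "individuals = UNIV \<times> {1..}"

(* Conditional law of the offspring numbers given the environment x: a product
   measure, i.e. they are independent and N (n, i) has law p (x n). *)
definition quenched_law :: "('e \<Rightarrow> nat pmf) \<Rightarrow> (nat \<Rightarrow> 'e) \<Rightarrow> (nat \<times> nat \<Rightarrow> nat) measure" where
  "quenched_law p x = Pi\<^sub>M individuals (\<lambda>(n, i). measure_pmf (p (x n)))"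

locale branching_process_random_env = prob_space M
  for M :: "'a measure" +
  fixes E :: "'e measure"
    and p :: "'e \<Rightarrow> nat pmf"
    and \<xi> :: "nat \<Rightarrow> 'a \<Rightarrow> 'e"
    and N :: "nat \<Rightarrow> nat \<Rightarrow> 'a \<Rightarrow> nat"
  assumes measurable_offspring_law: "\<And>i. (\<lambda>e. pmf (p e) i) \<in> borel_measurable E"
    and random_variable_env: "\<And>n. random_variable E (\<xi> n)"
    and indep_env: "indep_vars (\<lambda>_. E) \<xi> UNIV"
    and identical_env: "\<And>n. distr M E (\<xi> n) = distr M E (\<xi> 0)"
    and random_variable_offspring:
      "\<And>n i. i \<ge> 1 \<Longrightarrow> random_variable (count_space UNIV) (N n i)"
    (* P(dN, dx) = P_x(dN) tau(dx), where tau is the law of the environment sequence *)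
    and offspring_law_given_env:
      "\<And>A B. A \<in> sets (Pi\<^sub>M individuals (\<lambda>_. count_space UNIV)) \<Longrightarrow>
         B \<in> sets (Pi\<^sub>M UNIV (\<lambda>_. E)) \<Longrightarrow>
         emeasure M {\<omega> \<in> space M. (\<lambda>(n, i)\<in>individuals. N n i \<omega>) \<in> A \<and> (\<lambda>n. \<xi> n \<omega>) \<in> B} =
         (\<integral>\<^sup>+x\<in>B. emeasure (quenched_law p x) A \<partial>distr M (Pi\<^sub>M UNIV (\<lambda>_. E)) (\<lambda>\<omega> n. \<xi> n \<omega>))"

primrec population :: "(nat \<Rightarrow> nat \<Rightarrow> 'a \<Rightarrow> nat) \<Rightarrow> nat \<Rightarrow> 'a \<Rightarrow> nat" where
  "population N 0 \<omega> = 1"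
| "population N (Suc n) \<omega> = (\<Sum>i = 1..population N n \<omega>. N n i \<omega>)"

end

theory Submission
  imports Defs
begin


text \<open>Write r for the ratio of the populations in generations n0+n and n0, m_k for the
  conditional means and L = ln(2/\<delta>). Where r and the m_k are positive and finite, ln r is the
  sum of the n terms ln m_k, n0 \<le> k < n0+n, plus the logarithm of the normalised ratio r /
  (product of the m_k). If \<mu> < A_n, then ln r exceeds n(\<mu> + \<Delta>). Since \<Delta> \<ge>
  x + L/n for a suitable x, either the sum is at least n\<mu> + nx or the normalised ratio is above
  2/\<delta>. Each alternative has probability at most \<delta>/2.

  The sum is handled by Bernstein's inequality (\<open>bernstein_exponential_moment\<close>,
  \<open>bernstein_tail\<close>), with x chosen so that the exponent equals L. The moment condition
  bounds odd moments from above only, so the exponential series cannot be dominated in absolute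
  value. Fatou's lemma is applied along Taylor polynomials of even degree, which are positive.

  For the ratio, given the environment and the past, generation k+1 has m_k times the size of
  generation k as its mean. Hence the quenched mean of r is at most the product of the m_k
  (\<open>nn_integral_quenched_population_ratio_le\<close>). Disintegration over the environment
  (\<open>nn_integral_offspring_env\<close>) bounds the annealed mean of the normalised ratio by 1,
  and Markov's inequality finishes.\<close>

section \<open>Exponential moments and Bernstein's inequality\<close>

lemma nn_integral_Markov_inequality_space:
  assumes "u \<in> borel_measurable M"
  shows "emeasure M {\<omega> \<in> space M. 1 \<le> c * u \<omega>} \<le> c * (\<integral>\<^sup>+\<omega>. u \<omega> \<partial>M)"
proof -
  have "(\<integral>\<^sup>+\<omega>\<in>space M. u \<omega> \<partial>M) = (\<integral>\<^sup>+\<omega>. u \<omega> \<partial>M)"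
    by (intro nn_integral_cong) simp
  then show ?thesis
    using nn_integral_Markov_inequality[of u "space M" M c] assms by simp
qed

text \<open>For negative x the Lagrange remainder carries an odd power of x, so the polynomial lies
  above exp x. For other x the constant term 1 suffices.\<close>

lemma exp_taylor_even_pos:
  fixes x :: real
  shows "0 < (\<Sum>k<2 * m + 1. x ^ k / fact k)"
proof (cases "x \<ge> 0")
  case True
  have "0 < 1 + (\<Sum>k<2 * m. x ^ Suc k / fact (Suc k))"
    using True by (intro add_pos_nonneg sum_nonneg) auto
  then show ?thesis
    by (simp add: sum.lessThan_Suc_shift del: sum.lessThan_Suc)
next
  case False
  obtain t where "exp x = (\<Sum>k<2 * m + 1. x ^ k / fact k) + exp t / fact (2 * m + 1) * x ^ (2 * m + 1)"
    using Maclaurin_exp_le by blast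
  moreover have "exp t / fact (2 * m + 1) * x ^ (2 * m + 1) \<le> 0"
    using False by (intro mult_nonneg_nonpos) (auto simp: mult_nonpos_nonneg)
  ultimately show ?thesis
    using exp_gt_zero[of x] by linarith
qed

context prob_space
begin

text \<open>The partial Taylor sums of even degree are positive, so Fatou's lemma bounds the
  exponential moment although the odd moments are only bounded from above.\<close>

lemma bernstein_exponential_moment:
  fixes Y :: "'a \<Rightarrow> real"
  assumes int: "\<And>k. integrable M (\<lambda>\<omega>. Y \<omega> ^ k)"
    and mean: "expectation Y = 0"
    and moments: "\<And>k. k \<ge> 3 \<Longrightarrow>
      expectation (\<lambda>\<omega>. Y \<omega> ^ k) \<le> 1 / 2 * fact k * H ^ (k - 2) * expectation (\<lambda>\<omega>. (Y \<omega>)\<^sup>2)"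
    and t: "0 \<le> t" "0 \<le> H" "t * H < 1"
  shows "(\<integral>\<^sup>+\<omega>. exp (t * Y \<omega>) \<partial>M)
    \<le> exp (t\<^sup>2 * expectation (\<lambda>\<omega>. (Y \<omega>)\<^sup>2) / (2 * (1 - t * H)))"
proof -
  define v where "v = expectation (\<lambda>\<omega>. (Y \<omega>)\<^sup>2)"
  define c where "c k = t ^ k / fact k * expectation (\<lambda>\<omega>. Y \<omega> ^ k)" for k
  define b where "b = t\<^sup>2 * v / 2"
  have v: "v \<ge> 0" unfolding v_def by simp
  then have b: "b \<ge> 0" unfolding b_def by simp
  have [measurable]: "Y \<in> borel_measurable M"
    using int[of 1] by simp
  \<comment> \<open>The factorial in the moment condition cancels the one in the Taylor coefficient
    and leaves a geometric term. The case k = 0 is the variance itself.\<close>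
  have c_le: "c (Suc (Suc k)) \<le> b * (t * H) ^ k" for k
  proof (cases "k = 0")
    case True
    then show ?thesis by (simp add: c_def b_def v_def power2_eq_square)
  next
    case False
    have "c (Suc (Suc k)) \<le> t ^ Suc (Suc k) / fact (Suc (Suc k)) * (1 / 2 * fact (Suc (Suc k)) * H ^ k * v)"
      unfolding c_def using moments[of "Suc (Suc k)"] False t
      by (intro mult_left_mono) (auto simp: v_def simp del: fact_Suc)
    also have "\<dots> = b * (t * H) ^ k"
      by (simp add: b_def power_mult_distrib power2_eq_square field_simps del: fact_Suc)
    finally show ?thesis .
  qed
  have geom: "(\<Sum>k<n. (t * H) ^ k) \<le> 1 / (1 - t * H)" for n
    using t by (subst suminf_geometric[symmetric], simp) (intro sum_le_suminf summable_geometric, auto)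
  have sum_c: "(\<Sum>k<n. c k) \<le> 1 + b / (1 - t * H)" for n
  proof -
    \<comment> \<open>The first two coefficients are 1 and 0, the latter because Y is centred; only
      the terms from the variance on are compared with the geometric series.\<close>
    have "(\<Sum>k<Suc (Suc n). c k) = 1 + (\<Sum>k<n. c (Suc (Suc k)))" for n
      using mean by (simp add: sum.lessThan_Suc_shift c_def prob_space del: sum.lessThan_Suc)
    also have "\<dots> n \<le> 1 + (\<Sum>k<n. b * (t * H) ^ k)" for n
      using c_le by (intro add_left_mono sum_mono) auto
    also have "\<dots> n \<le> 1 + b / (1 - t * H)" for n
      using mult_left_mono[OF geom b] by (simp flip: sum_distrib_left)
    finally have *: "(\<Sum>k<Suc (Suc n). c k) \<le> 1 + b / (1 - t * H)" for n .
    have pos: "b / (1 - t * H) \<ge> 0" using b t by simp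
    consider "n = 0" | "n = 1" | n' where "n = Suc (Suc n')"
      by (metis One_nat_def not0_implies_Suc)
    then show ?thesis
      using * pos by cases (auto simp: c_def prob_space)
  qed
  \<comment> \<open>Positivity of the even-degree polynomial is what identifies the nonnegative
    integral with the Bochner integral, so that moments of either sign enter.\<close>
  have integral_taylor:
    "(\<integral>\<^sup>+\<omega>. ennreal (\<Sum>k<2 * m + 1. (t * Y \<omega>) ^ k / fact k) \<partial>M) = ennreal (\<Sum>k<2 * m + 1. c k)" for m
  proof (subst nn_integral_eq_integral)
    show "integrable M (\<lambda>\<omega>. \<Sum>k<2 * m + 1. (t * Y \<omega>) ^ k / fact k)"
      using int by (simp add: power_mult_distrib)
    show "AE \<omega> in M. 0 \<le> (\<Sum>k<2 * m + 1. (t * Y \<omega>) ^ k / fact k)"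
      using exp_taylor_even_pos by (auto intro: less_imp_le)
    have "(\<integral>\<omega>. (\<Sum>k<2 * m + 1. (t * Y \<omega>) ^ k / fact k) \<partial>M)
        = (\<Sum>k<2 * m + 1. \<integral>\<omega>. (t * Y \<omega>) ^ k / fact k \<partial>M)"
      using int by (intro Bochner_Integration.integral_sum) (simp add: power_mult_distrib)
    then show "ennreal (\<integral>\<omega>. (\<Sum>k<2 * m + 1. (t * Y \<omega>) ^ k / fact k) \<partial>M) = ennreal (\<Sum>k<2 * m + 1. c k)"
      by (simp add: c_def power_mult_distrib)
  qed
  have exp_lim: "ennreal (exp y) = liminf (\<lambda>m. ennreal (\<Sum>k<2 * m + 1. y ^ k / fact k))" for y :: real
  proof -
    have "(\<lambda>n. \<Sum>k<n. y ^ k / fact k) \<longlonglongrightarrow> exp y"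
      using exp_converges[of y] by (simp add: sums_def divide_inverse mult.commute)
    then have "(\<lambda>m. ennreal (\<Sum>k<2 * m + 1. y ^ k / fact k)) \<longlonglongrightarrow> ennreal (exp y)"
      by (intro tendsto_ennrealI LIMSEQ_subseq_LIMSEQ[of _ _ "\<lambda>m. 2 * m + 1", unfolded comp_def])
        (auto simp: strict_mono_def)
    then show ?thesis
      by (simp add: lim_imp_Liminf)
  qed
  have "(\<integral>\<^sup>+\<omega>. exp (t * Y \<omega>) \<partial>M)
      = (\<integral>\<^sup>+\<omega>. liminf (\<lambda>m. ennreal (\<Sum>k<2 * m + 1. (t * Y \<omega>) ^ k / fact k)) \<partial>M)"
    by (simp only: exp_lim)
  also have "\<dots> \<le> liminf (\<lambda>m. \<integral>\<^sup>+\<omega>. ennreal (\<Sum>k<2 * m + 1. (t * Y \<omega>) ^ k / fact k) \<partial>M)"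
    by (intro nn_integral_liminf) simp
  also have "\<dots> = liminf (\<lambda>m. ennreal (\<Sum>k<2 * m + 1. c k))"
    by (simp only: integral_taylor)
  also have "\<dots> \<le> liminf (\<lambda>m::nat. ennreal (1 + b / (1 - t * H)))"
    using sum_c by (intro Liminf_mono always_eventually allI ennreal_leI)
  also have "\<dots> = ennreal (1 + b / (1 - t * H))"
    by (simp add: Liminf_const)
  also have "\<dots> \<le> ennreal (exp (b / (1 - t * H)))"
    by (intro ennreal_leI exp_ge_add_one_self)
  finally show ?thesis
    using t by (simp add: b_def v_def field_simps)
qed

text \<open>Chernoff's method: Markov's inequality for the exponential of t times the sum,
  factorised by independence. Integrals stay in [0,\<infinity>], so no integrability has to be
  checked.\<close>

lemma bernstein_tail:
  fixes Y :: "'i \<Rightarrow> 'a \<Rightarrow> real" and H v x :: real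
  assumes fin: "finite I" and indep: "indep_vars (\<lambda>_. borel) Y I"
    and moment: "\<And>i t. i \<in> I \<Longrightarrow> 0 \<le> t \<Longrightarrow> t * H < 1 \<Longrightarrow>
      (\<integral>\<^sup>+\<omega>. exp (t * Y i \<omega>) \<partial>M) \<le> exp (t\<^sup>2 * v / (2 * (1 - t * H)))"
    and pos: "0 < v" "0 \<le> H" "0 \<le> x"
  shows "prob {\<omega> \<in> space M. card I * x \<le> (\<Sum>i\<in>I. Y i \<omega>)}
    \<le> exp (- (card I * x\<^sup>2 / (2 * (v + H * x))))"
proof -
  \<comment> \<open>With this t the logarithm of each exponential moment is bounded by t x / 2, half
    of the gain t x from Markov's inequality. Positivity of v makes t H < 1 strict.\<close>
  define t where "t = x / (v + H * x)"
  define n where "n = real (card I)"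
  have d: "v + H * x > 0" using pos by (simp add: add_pos_nonneg)
  have t: "0 \<le> t" "t * H < 1"
    using pos d by (auto simp: t_def field_simps)
  have e: "1 - t * H = v / (v + H * x)"
    using d by (simp add: t_def field_simps)
  have s: "t\<^sup>2 * v / (2 * (1 - t * H)) = t * x / 2"
    using d pos unfolding e by (simp add: t_def power2_eq_square)
  have [measurable]: "i \<in> I \<Longrightarrow> Y i \<in> borel_measurable M" for i
    using indep by (auto simp: indep_vars_def)
  have "emeasure M {\<omega> \<in> space M. n * x \<le> (\<Sum>i\<in>I. Y i \<omega>)}
      \<le> emeasure M {\<omega> \<in> space M. 1 \<le> ennreal (exp (- (t * n * x))) * (\<Prod>i\<in>I. ennreal (exp (t * Y i \<omega>)))}"
  proof (rule emeasure_mono)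
    show "{\<omega> \<in> space M. n * x \<le> (\<Sum>i\<in>I. Y i \<omega>)}
      \<subseteq> {\<omega> \<in> space M. 1 \<le> ennreal (exp (- (t * n * x))) * (\<Prod>i\<in>I. ennreal (exp (t * Y i \<omega>)))}"
    proof safe
      fix \<omega> assume "n * x \<le> (\<Sum>i\<in>I. Y i \<omega>)"
      then have "t * (n * x) \<le> (\<Sum>i\<in>I. t * Y i \<omega>)"
        using t by (simp add: mult_left_mono flip: sum_distrib_left)
      then have "1 \<le> exp (- (t * n * x) + (\<Sum>i\<in>I. t * Y i \<omega>))" by simp
      also have "\<dots> = exp (- (t * n * x)) * (\<Prod>i\<in>I. exp (t * Y i \<omega>))"
        by (simp only: exp_add exp_sum[OF fin])
      finally show "1 \<le> ennreal (exp (- (t * n * x))) * (\<Prod>i\<in>I. ennreal (exp (t * Y i \<omega>)))"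
        by (simp add: prod_ennreal ennreal_mult'[symmetric] del: mult_minus_left)
    qed
  qed measurable
  also have "\<dots> \<le> ennreal (exp (- (t * n * x))) * (\<integral>\<^sup>+\<omega>. (\<Prod>i\<in>I. ennreal (exp (t * Y i \<omega>))) \<partial>M)"
    by (intro nn_integral_Markov_inequality_space) measurable
  also have "\<dots> = ennreal (exp (- (t * n * x))) * (\<Prod>i\<in>I. \<integral>\<^sup>+\<omega>. exp (t * Y i \<omega>) \<partial>M)"
    using fin by (subst indep_vars_nn_integral) (auto intro!: indep_vars_compose2[OF indep])
  also have "\<dots> \<le> ennreal (exp (- (t * n * x))) * (\<Prod>i\<in>I. ennreal (exp (t * x / 2)))"
    using moment[OF _ t] unfolding s by (intro mult_left_mono prod_mono_ennreal) auto
  also have "\<dots> = ennreal (exp (- (t * n * x) + n * (t * x / 2)))"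
    unfolding exp_add by (simp add: n_def ennreal_mult' ennreal_power flip: exp_of_nat_mult)
  also have "- (t * n * x) + n * (t * x / 2) = - (n * x * t / 2)"
    by (simp add: field_simps)
  also have "\<dots> = - (n * x\<^sup>2 / (2 * (v + H * x)))"
    by (simp add: t_def power2_eq_square algebra_simps)
  finally show ?thesis
    by (simp add: emeasure_eq_measure n_def)
qed

end
section \<open>The process in a fixed environment\<close>

lemma (in prob_space) indep_var_nn_integral:
  fixes f g :: "'a \<Rightarrow> ennreal"
  assumes "indep_var borel f borel g"
  shows "(\<integral>\<^sup>+\<omega>. f \<omega> * g \<omega> \<partial>M) = (\<integral>\<^sup>+\<omega>. f \<omega> \<partial>M) * (\<integral>\<^sup>+\<omega>. g \<omega> \<partial>M)"
proof -
  have "case_bool borel borel = (\<lambda>_. borel :: ennreal measure)"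
    by (auto split: bool.split)
  then have "indep_vars (\<lambda>_. borel) (case_bool f g) UNIV"
    using assms by (simp add: indep_var_def)
  from indep_vars_nn_integral[OF _ this] show ?thesis
    by (simp add: UNIV_bool mult.commute)
qed

text \<open>Independence means that the joint law is the product of the marginals. Here the joint
  map is the identity on the product space, as its points are already extensional.\<close>

lemma indep_vars_PiM_components:
  assumes M: "\<And>i. i \<in> I \<Longrightarrow> prob_space (M i)" and I: "I \<noteq> {}"
  shows "prob_space.indep_vars (Pi\<^sub>M I M) M (\<lambda>i \<omega>. \<omega> i) I"
proof -
  interpret prob_space "Pi\<^sub>M I M" by (rule prob_space_PiM[OF M])
  have "distr (Pi\<^sub>M I M) (Pi\<^sub>M I M) (\<lambda>\<omega>. \<lambda>i\<in>I. \<omega> i) = distr (Pi\<^sub>M I M) (Pi\<^sub>M I M) (\<lambda>\<omega>. \<omega>)"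
    by (intro distr_cong) (auto simp: space_PiM PiE_restrict)
  also have "\<dots> = Pi\<^sub>M I (\<lambda>i. distr (Pi\<^sub>M I M) (M i) (\<lambda>\<omega>. \<omega> i))"
    using M by (auto intro!: PiM_cong simp: distr_PiM_component distr_id2)
  finally show ?thesis
    using I by (subst indep_vars_iff_distr_eq_PiM') auto
qed

text \<open>The population as a function of the offspring numbers alone, so that it lives on the space of
  the quenched law.\<close>

definition coordinate_population :: "nat \<Rightarrow> (nat \<times> nat \<Rightarrow> nat) \<Rightarrow> nat" where
  "coordinate_population = population (\<lambda>n i \<nu>. \<nu> (n, i))"

lemma coordinate_population_0: "coordinate_population 0 \<nu> = 1"
  and coordinate_population_Suc: "coordinate_population (Suc n) \<nu> =
    (\<Sum>i = 1..coordinate_population n \<nu>. \<nu> (n, i))"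
  by (simp_all add: coordinate_population_def)

text \<open>The recursion reads only indices i \<ge> 1, so the restriction to
  \<open>individuals\<close> is invisible to it.\<close>

lemma population_eq_coordinate_population:
  "population N n \<omega> = coordinate_population n (\<lambda>(n, i)\<in>individuals. N n i \<omega>)"
  by (induction n) (auto simp: coordinate_population_0 coordinate_population_Suc individuals_def
      intro!: sum.cong)

text \<open>Generation j is determined by the offspring numbers of earlier generations. This makes
  it a function of the past before k.\<close>

lemma coordinate_population_restrict:
  assumes "j \<le> k"
  shows "coordinate_population j (restrict \<nu> ({..<k} \<times> {1..})) = coordinate_population j \<nu>"
  using assms by (induction j) (auto simp: coordinate_population_0 coordinate_population_Suc
      intro!: sum.cong)

text \<open>The random upper limit of the sum takes countably many values, so it suffices to treat
  fixed limits. \<open>J\<close> is left free to cover both the past alone and all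
  individuals.\<close>

lemma measurable_coordinate_population:
  assumes "{..<k} \<times> {1..} \<subseteq> J" and "j \<le> k"
  shows "coordinate_population j \<in> Pi\<^sub>M J (\<lambda>_. count_space UNIV) \<rightarrow>\<^sub>M count_space UNIV"
  using \<open>j \<le> k\<close>
proof (induction j)
  case 0
  then show ?case by (simp add: coordinate_population_0[abs_def])
next
  case (Suc j)
  have "(\<lambda>\<nu>. \<Sum>i = 1..n. \<nu> (j, i)) \<in> Pi\<^sub>M J (\<lambda>_. count_space UNIV) \<rightarrow>\<^sub>M (count_space UNIV :: nat measure)" for n :: nat
  proof (induction n)
    case (Suc n)
    have comp: "(\<lambda>\<nu>. \<nu> (j, Suc n)) \<in> Pi\<^sub>M J (\<lambda>_. count_space UNIV) \<rightarrow>\<^sub>M (count_space UNIV :: nat measure)"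
      using assms \<open>Suc j \<le> k\<close> by (intro measurable_component_singleton) auto
    have "(\<lambda>\<nu>. m + \<nu> (j, Suc n)) \<in> Pi\<^sub>M J (\<lambda>_. count_space UNIV) \<rightarrow>\<^sub>M count_space UNIV" for m :: nat
      using measurable_compose[OF comp, of "\<lambda>y. m + y" "count_space UNIV"] by simp
    from measurable_compose_countable[OF this Suc.IH] show ?case
      by simp
  qed simp
  moreover have "coordinate_population j \<in> Pi\<^sub>M J (\<lambda>_. count_space UNIV) \<rightarrow>\<^sub>M count_space UNIV"
    using Suc by simp
  ultimately show ?case
    unfolding coordinate_population_Suc[abs_def] by (rule measurable_compose_countable)
qed

section \<open>Conditional means and the quenched mean of a population ratio\<close>

lemma offspring_mean_eq_nn_integral: "offspring_mean q = (\<integral>\<^sup>+y. of_nat y \<partial>measure_pmf q)"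
  by (simp add: nn_integral_measure_pmf nn_integral_count_space_nat offspring_mean_def mult.commute)

lemma offspring_mean_ge_1:
  assumes "pmf q 0 = 0"
  shows "offspring_mean q \<ge> 1"
proof -
  have "1 \<le> (of_nat y :: ennreal)" if "y \<in> set_pmf q" for y
    using that assms by (cases y) (auto simp: set_pmf_iff)
  then have "(\<integral>\<^sup>+y. 1 \<partial>measure_pmf q) \<le> offspring_mean q"
    unfolding offspring_mean_eq_nn_integral by (intro nn_integral_mono_AE) (auto simp: AE_measure_pmf_iff)
  then show ?thesis by simp
qed

lemma sets_quenched_law: "sets (quenched_law p x) = sets (Pi\<^sub>M individuals (\<lambda>_. count_space UNIV))"
  unfolding quenched_law_def by (intro sets_PiM_cong) auto

lemma prob_space_quenched_law: "prob_space (quenched_law p x)"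
  unfolding quenched_law_def
  by (intro prob_space_PiM) (auto simp: measure_pmf.prob_space_axioms)

lemma nn_integral_quenched_component:
  assumes "i \<ge> 1"
  shows "(\<integral>\<^sup>+\<nu>. of_nat (\<nu> (k, i)) \<partial>quenched_law p x) = offspring_mean (p (x k))"
proof -
  let ?M = "\<lambda>(n, i::nat). measure_pmf (p (x n))"
  have ki: "(k, i) \<in> individuals" using assms by (simp add: individuals_def)
  have comp: "(\<lambda>\<nu>. \<nu> (k, i)) \<in> Pi\<^sub>M individuals ?M \<rightarrow>\<^sub>M ?M (k, i)"
    using ki by (rule measurable_component_singleton)
  have "(\<integral>\<^sup>+\<nu>. of_nat (\<nu> (k, i)) \<partial>quenched_law p x)
      = (\<integral>\<^sup>+y. of_nat y \<partial>distr (Pi\<^sub>M individuals ?M) (?M (k, i)) (\<lambda>\<nu>. \<nu> (k, i)))"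
    unfolding quenched_law_def by (subst nn_integral_distr[OF comp]) simp_all
  also have "distr (Pi\<^sub>M individuals ?M) (?M (k, i)) (\<lambda>\<nu>. \<nu> (k, i)) = measure_pmf (p (x k))"
    using ki by (subst distr_PiM_component) (auto simp: measure_pmf.prob_space_axioms)
  also have "(\<integral>\<^sup>+y. of_nat y \<partial>measure_pmf (p (x k))) = offspring_mean (p (x k))"
    by (rule offspring_mean_eq_nn_integral[symmetric])
  finally show ?thesis .
qed

text \<open>The past before k and the coordinate (k, i) are disjoint blocks of a product measure,
  hence independent. The hypothesis \<open>restrict\<close> says that \<open>g\<close> depends on
  the past block only.\<close>

lemma nn_integral_quenched_past_times_component:
  fixes g :: "(nat \<times> nat \<Rightarrow> nat) \<Rightarrow> ennreal"
  assumes g: "g \<in> borel_measurable (Pi\<^sub>M ({..<k} \<times> {1..}) (\<lambda>_. count_space UNIV))"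
    and restrict: "\<And>\<nu>. g (restrict \<nu> ({..<k} \<times> {1..})) = g \<nu>" and i: "i \<ge> 1"
  shows "(\<integral>\<^sup>+\<nu>. g \<nu> * of_nat (\<nu> (k, i)) \<partial>quenched_law p x)
    = (\<integral>\<^sup>+\<nu>. g \<nu> \<partial>quenched_law p x) * offspring_mean (p (x k))"
proof -
  let ?M = "\<lambda>(n, i::nat). measure_pmf (p (x n))" and ?A = "{..<k} \<times> {1::nat..}" and ?B = "{(k, i)}"
  interpret prob_space "quenched_law p x" by (rule prob_space_quenched_law)
  have "indep_vars ?M (\<lambda>i \<nu>. \<nu> i) individuals"
    unfolding quenched_law_def
    by (rule indep_vars_PiM_components) (auto simp: measure_pmf.prob_space_axioms individuals_def)
  then have "indep_var (Pi\<^sub>M ?A ?M) (\<lambda>\<nu>. restrict (\<lambda>i. \<nu> i) ?A) (Pi\<^sub>M ?B ?M) (\<lambda>\<nu>. restrict (\<lambda>i. \<nu> i) ?B)"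
    using i by (intro indep_var_restrict) (auto simp: individuals_def)
  then have "indep_var borel (g \<circ> (\<lambda>\<nu>. restrict \<nu> ?A)) borel ((\<lambda>\<nu>. of_nat (\<nu> (k, i))) \<circ> (\<lambda>\<nu>. restrict \<nu> ?B))"
  proof (rule indep_var_compose)
    have "sets (Pi\<^sub>M ?A ?M) = sets (Pi\<^sub>M ?A (\<lambda>_. count_space UNIV))"
      by (intro sets_PiM_cong) auto
    with g show "g \<in> borel_measurable (Pi\<^sub>M ?A ?M)"
      by (simp cong: measurable_cong_sets)
    have "(\<lambda>\<nu>. \<nu> (k, i)) \<in> Pi\<^sub>M ?B ?M \<rightarrow>\<^sub>M ?M (k, i)"
      by (intro measurable_component_singleton) simp
    then show "(\<lambda>\<nu>. of_nat (\<nu> (k, i)) :: ennreal) \<in> borel_measurable (Pi\<^sub>M ?B ?M)"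
      by (rule measurable_compose) simp
  qed
  from indep_var_nn_integral[OF this] show ?thesis
    by (simp only: comp_def restrict restrict_apply singleton_iff simp_thms if_True
        nn_integral_quenched_component[OF i])
qed

text \<open>A Wald-type identity: the sum of random length becomes a series over all potential
  individuals, each weighted by a function of the past. Division by generation j preserves this
  dependence because j \<le> k.\<close>

lemma nn_integral_quenched_population_ratio_Suc:
  assumes "j \<le> k"
  shows "(\<integral>\<^sup>+\<nu>. ennreal (coordinate_population (Suc k) \<nu> / coordinate_population j \<nu>) \<partial>quenched_law p x)
    = (\<integral>\<^sup>+\<nu>. ennreal (coordinate_population k \<nu> / coordinate_population j \<nu>) \<partial>quenched_law p x)
      * offspring_mean (p (x k))"
proof -
  let ?A = "{..<k} \<times> {1::nat..}" and ?Z = "coordinate_population"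
  \<comment> \<open>The weight counts from 0, so index \<open>i\<close> stands for individual
    \<open>Suc i\<close>.\<close>
  define g where "g i \<nu> = (if i < ?Z k \<nu> then ennreal (1 / ?Z j \<nu>) else 0)" for i \<nu>
  have meas: "g i \<in> borel_measurable (Pi\<^sub>M J (\<lambda>_. count_space UNIV))" if "?A \<subseteq> J" for i J
  proof -
    note [measurable] = measurable_coordinate_population[OF that order.refl]
      measurable_coordinate_population[OF that assms]
    show ?thesis unfolding g_def by measurable
  qed
  have A: "?A \<subseteq> individuals" by (auto simp: individuals_def)
  have [measurable]: "g i \<in> borel_measurable (quenched_law p x)" for i
    using meas[OF A, of i] by (simp add: sets_quenched_law cong: measurable_cong_sets)
  have comp [measurable]: "(\<lambda>\<nu>. of_nat (\<nu> (k, Suc i)) :: ennreal) \<in> borel_measurable (quenched_law p x)" for i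
  proof -
    have "(\<lambda>\<nu>. \<nu> (k, Suc i)) \<in> Pi\<^sub>M individuals (\<lambda>_. count_space UNIV) \<rightarrow>\<^sub>M (count_space UNIV :: nat measure)"
      by (intro measurable_component_singleton) (simp add: individuals_def)
    then have "(\<lambda>\<nu>. of_nat (\<nu> (k, Suc i)) :: ennreal) \<in> borel_measurable (Pi\<^sub>M individuals (\<lambda>_. count_space UNIV :: nat measure))"
      by (rule measurable_compose) simp
    then show ?thesis
      by (simp add: sets_quenched_law cong: measurable_cong_sets)
  qed
  have g_restrict: "g i (restrict \<nu> ?A) = g i \<nu>" for i \<nu>
    using assms by (simp add: g_def coordinate_population_restrict del: One_nat_def)
  \<comment> \<open>Whether individual \<open>i + 1\<close> of generation \<open>k\<close> exists depends on the generations before \<open>k\<close>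
    only, hence is independent of its number of children.\<close>
  have ratio_Suc: "ennreal (?Z (Suc k) \<nu> / ?Z j \<nu>) = (\<Sum>i. g i \<nu> * of_nat (\<nu> (k, Suc i)))" for \<nu>
  proof -
    have "(\<Sum>i. g i \<nu> * of_nat (\<nu> (k, Suc i))) = (\<Sum>i<?Z k \<nu>. g i \<nu> * of_nat (\<nu> (k, Suc i)))"
      by (rule suminf_finite) (auto simp: g_def)
    also have "\<dots> = (\<Sum>i<?Z k \<nu>. ennreal (\<nu> (k, Suc i) / ?Z j \<nu>))"
      by (intro sum.cong) (auto simp: g_def ennreal_of_nat_eq_real_of_nat ennreal_mult'[symmetric])
    also have "\<dots> = ennreal (\<Sum>i<?Z k \<nu>. \<nu> (k, Suc i) / ?Z j \<nu>)"
      by (simp add: sum_ennreal)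
    also have "(\<Sum>i<?Z k \<nu>. \<nu> (k, Suc i) / ?Z j \<nu>) = ?Z (Suc k) \<nu> / ?Z j \<nu>"
      unfolding coordinate_population_Suc
      by (simp add: sum.atLeast1_atMost_eq flip: sum_divide_distrib)
    finally show ?thesis by simp
  qed
  have ratio: "ennreal (?Z k \<nu> / ?Z j \<nu>) = (\<Sum>i. g i \<nu>)" for \<nu>
  proof -
    have "(\<Sum>i. g i \<nu>) = (\<Sum>i<?Z k \<nu>. g i \<nu>)"
      by (rule suminf_finite) (auto simp: g_def)
    also have "\<dots> = ennreal (?Z k \<nu> / ?Z j \<nu>)"
      by (simp add: g_def ennreal_of_nat_eq_real_of_nat ennreal_mult'[symmetric])
    finally show ?thesis by simp
  qed
  have "(\<integral>\<^sup>+\<nu>. ennreal (?Z (Suc k) \<nu> / ?Z j \<nu>) \<partial>quenched_law p x)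
      = (\<Sum>i. \<integral>\<^sup>+\<nu>. g i \<nu> * of_nat (\<nu> (k, Suc i)) \<partial>quenched_law p x)"
    unfolding ratio_Suc by (intro nn_integral_suminf) measurable
  also have "\<dots> = (\<Sum>i. (\<integral>\<^sup>+\<nu>. g i \<nu> \<partial>quenched_law p x) * offspring_mean (p (x k)))"
    by (intro suminf_cong nn_integral_quenched_past_times_component meas g_restrict) auto
  also have "\<dots> = (\<integral>\<^sup>+\<nu>. ennreal (?Z k \<nu> / ?Z j \<nu>) \<partial>quenched_law p x) * offspring_mean (p (x k))"
    unfolding ratio by (simp add: nn_integral_suminf)
  finally show ?thesis .
qed

lemma nn_integral_quenched_population_ratio_le:
  "(\<integral>\<^sup>+\<nu>. ennreal (coordinate_population (j + n) \<nu> / coordinate_population j \<nu>) \<partial>quenched_law p x)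
    \<le> (\<Prod>k\<in>{j..<j + n}. offspring_mean (p (x k)))"
proof (induction n)
  \<comment> \<open>Only an inequality holds at the start: the quotient of a population by itself is
    0, not 1, when the population vanishes.\<close>
  case 0
  interpret prob_space "quenched_law p x" by (rule prob_space_quenched_law)
  have "(\<integral>\<^sup>+\<nu>. ennreal (coordinate_population j \<nu> / coordinate_population j \<nu>) \<partial>quenched_law p x)
      \<le> (\<integral>\<^sup>+\<nu>. 1 \<partial>quenched_law p x)"
    by (intro nn_integral_mono) auto
  then show ?case by (simp add: emeasure_space_1)
next
  case (Suc n)
  then show ?case
    by (simp add: nn_integral_quenched_population_ratio_Suc mult_right_mono)
qed

section \<open>The joint law of offspring numbers and environment\<close>

context branching_process_random_env
begin

abbreviation offspring_space :: "(nat \<times> nat \<Rightarrow> nat) measure" where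
  "offspring_space \<equiv> Pi\<^sub>M individuals (\<lambda>_. count_space UNIV)"

abbreviation env_space :: "(nat \<Rightarrow> 'e) measure" where
  "env_space \<equiv> Pi\<^sub>M UNIV (\<lambda>_. E)"

abbreviation offspring_numbers :: "'a \<Rightarrow> nat \<times> nat \<Rightarrow> nat" where
  "offspring_numbers \<omega> \<equiv> (\<lambda>(n, i)\<in>individuals. N n i \<omega>)"

lemma measurable_offspring_numbers [measurable]: "offspring_numbers \<in> M \<rightarrow>\<^sub>M offspring_space"
  using random_variable_offspring
  by (intro measurable_restrict) (auto simp: individuals_def)

lemma measurable_env [measurable]: "(\<lambda>\<omega> n. \<xi> n \<omega>) \<in> M \<rightarrow>\<^sub>M env_space"
proof -
  have "(\<lambda>\<omega>. \<lambda>n\<in>UNIV. \<xi> n \<omega>) \<in> M \<rightarrow>\<^sub>M env_space"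
    using random_variable_env by (intro measurable_restrict) auto
  then show ?thesis by (simp add: restrict_def)
qed

lemma measurable_offspring_mean [measurable]: "(\<lambda>e. offspring_mean (p e)) \<in> borel_measurable E"
proof -
  note [measurable] = measurable_offspring_law
  show ?thesis unfolding offspring_mean_def by measurable
qed

lemma measurable_emeasure_offspring_law:
  "(\<lambda>e. emeasure (measure_pmf (p e)) S) \<in> borel_measurable E"
proof -
  note [measurable] = measurable_offspring_law
  have "emeasure (measure_pmf (p e)) S = (\<Sum>i. ennreal (pmf (p e) i) * indicator S i)" for e
  proof -
    have "emeasure (measure_pmf (p e)) S = (\<integral>\<^sup>+i. indicator S i \<partial>measure_pmf (p e))"
      by simp
    also have "\<dots> = (\<Sum>i. ennreal (pmf (p e) i) * indicator S i)"
      by (simp only: nn_integral_measure_pmf nn_integral_count_space_nat)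
    finally show ?thesis .
  qed
  then show ?thesis by simp
qed

text \<open>Measurability of a probability kernel can be tested on the intersection-stable
  cylinders, where the quenched law is a finite product of measurable functions of the
  environment.\<close>

lemma measurable_quenched_law: "quenched_law p \<in> env_space \<rightarrow>\<^sub>M prob_algebra offspring_space"
proof (rule measurable_prob_algebra_generated[OF sets_PiM Int_stable_prod_algebra
      prod_algebra_sets_into_space prob_space_quenched_law sets_quenched_law])
  fix A :: "(nat \<times> nat \<Rightarrow> nat) set"
  assume "A \<in> prod_algebra individuals (\<lambda>_. count_space UNIV)"
  then obtain J S where A: "A = prod_emb individuals (\<lambda>_. count_space UNIV) J (\<Pi>\<^sub>E j\<in>J. S j)"
    and J: "finite J" "J \<subseteq> individuals"
    by (elim prod_algebraE)
  let ?M = "\<lambda>x. \<lambda>(n, i::nat). measure_pmf (p (x n))"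
  have "emeasure (quenched_law p x) A = (\<Prod>j\<in>J. emeasure (measure_pmf (p (x (fst j)))) (S j))" for x
  proof -
    have "A = prod_emb individuals (?M x) J (\<Pi>\<^sub>E j\<in>J. S j)"
      unfolding A prod_emb_def by (auto simp: PiE_iff split_beta)
    then have "emeasure (quenched_law p x) A = (\<Prod>j\<in>J. emeasure (?M x j) (S j))"
      unfolding quenched_law_def using J
      by (simp only:) (subst emeasure_PiM_emb, auto simp: split_beta measure_pmf.prob_space_axioms)
    then show ?thesis
      by (simp add: split_beta)
  qed
  then show "(\<lambda>x. emeasure (quenched_law p x) A) \<in> borel_measurable env_space"
    by (simp, intro borel_measurable_prod_ennreal measurable_compose[OF _ measurable_emeasure_offspring_law])
      (simp add: measurable_component_singleton)
qed

text \<open>The locale prescribes the joint law on rectangles A \<times> B only. These are stable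
  under intersection and generate the product \<sigma>-algebra, so both probability measures agree.
  The kernel on the right samples offspring numbers under the quenched law and keeps x.\<close>

lemma distr_offspring_env:
  "distr M (offspring_space \<Otimes>\<^sub>M env_space) (\<lambda>\<omega>. (offspring_numbers \<omega>, \<lambda>n. \<xi> n \<omega>)) =
    distr M env_space (\<lambda>\<omega> n. \<xi> n \<omega>) \<bind>
      (\<lambda>x. distr (quenched_law p x) (offspring_space \<Otimes>\<^sub>M env_space) (\<lambda>\<nu>. (\<nu>, x)))"
proof (rule measure_eqI_generator_eq[OF Int_stable_pair_measure_generator])
  note [measurable] = measurable_quenched_law
  let ?S = "offspring_space \<Otimes>\<^sub>M env_space"
  let ?L = "distr M ?S (\<lambda>\<omega>. (offspring_numbers \<omega>, \<lambda>n. \<xi> n \<omega>))"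
  let ?\<tau> = "distr M env_space (\<lambda>\<omega> n. \<xi> n \<omega>)"
  let ?K = "\<lambda>x. distr (quenched_law p x) ?S (\<lambda>\<nu>. (\<nu>, x))"
  have K: "?K \<in> env_space \<rightarrow>\<^sub>M prob_algebra ?S"
    by measurable
  have \<tau>: "?\<tau> \<in> space (prob_algebra env_space)"
    by (simp add: space_prob_algebra prob_space_distr)
  show "{a \<times> b |a b. a \<in> sets offspring_space \<and> b \<in> sets env_space} \<subseteq> Pow (space ?S)"
    unfolding space_pair_measure by (rule pair_measure_closed)
  show "sets ?L = sigma_sets (space ?S) {a \<times> b |a b. a \<in> sets offspring_space \<and> b \<in> sets env_space}"
    by (simp add: sets_pair_measure space_pair_measure)
  have "sets (?\<tau> \<bind> ?K) = sets ?S"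
    using prob_space.not_empty[OF prob_space_distr[OF measurable_env]] by (intro sets_bind) simp_all
  then show "sets (?\<tau> \<bind> ?K) = sigma_sets (space ?S) {a \<times> b |a b. a \<in> sets offspring_space \<and> b \<in> sets env_space}"
    by (simp add: sets_pair_measure space_pair_measure)
  fix X assume "X \<in> {a \<times> b |a b. a \<in> sets offspring_space \<and> b \<in> sets env_space}"
  then obtain A B where X: "X = A \<times> B" and A [measurable]: "A \<in> sets offspring_space"
    and B [measurable]: "B \<in> sets env_space" by auto
  have "emeasure ?L X = emeasure M {\<omega> \<in> space M. offspring_numbers \<omega> \<in> A \<and> (\<lambda>n. \<xi> n \<omega>) \<in> B}"
    unfolding X by (subst emeasure_distr) (auto intro!: arg_cong[where f = "emeasure M"])
  also have "\<dots> = (\<integral>\<^sup>+x\<in>B. emeasure (quenched_law p x) A \<partial>?\<tau>)"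
    by (rule offspring_law_given_env[OF A B])
  also have "\<dots> = (\<integral>\<^sup>+x. emeasure (?K x) X \<partial>?\<tau>)"
  proof (rule nn_integral_cong)
    fix x assume x: "x \<in> space ?\<tau>"
    have "emeasure (?K x) X = emeasure (quenched_law p x) ((\<lambda>\<nu>. (\<nu>, x)) -` X \<inter> space (quenched_law p x))"
      unfolding X using x by (intro emeasure_distr) (auto simp: sets_quenched_law cong: measurable_cong_sets)
    \<comment> \<open>The slice of the rectangle at x is all of A or empty, which reproduces the
      indicator of B.\<close>
    also have "(\<lambda>\<nu>. (\<nu>, x)) -` X \<inter> space (quenched_law p x) = (if x \<in> B then A else {})"
      using sets.sets_into_space[OF A] sets_eq_imp_space_eq[OF sets_quenched_law, of p x] by (auto simp: X)
    finally show "emeasure (quenched_law p x) A * indicator B x = emeasure (?K x) X"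
      by auto
  qed
  also have "\<dots> = emeasure (?\<tau> \<bind> ?K) X"
    unfolding X by (rule emeasure_bind_prob_algebra[OF \<tau> K, symmetric]) measurable
  finally show "emeasure ?L X = emeasure (?\<tau> \<bind> ?K) X" .
next
  show "range (\<lambda>_::nat. space offspring_space \<times> space env_space)
      \<subseteq> {a \<times> b |a b. a \<in> sets offspring_space \<and> b \<in> sets env_space}"
    by auto
  show "(\<Union>i::nat. space offspring_space \<times> space env_space) = space (offspring_space \<Otimes>\<^sub>M env_space)"
    by (simp add: space_pair_measure)
  interpret L: prob_space "distr M (offspring_space \<Otimes>\<^sub>M env_space) (\<lambda>\<omega>. (offspring_numbers \<omega>, \<lambda>n. \<xi> n \<omega>))"
    by (rule prob_space_distr) measurable
  show "emeasure (distr M (offspring_space \<Otimes>\<^sub>M env_space) (\<lambda>\<omega>. (offspring_numbers \<omega>, \<lambda>n. \<xi> n \<omega>)))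
      (space offspring_space \<times> space env_space) \<noteq> \<infinity>" for i :: nat
    by simp
qed

text \<open>This carries the disintegration from sets to nonnegative functions, so that bounds valid
  in every fixed environment can be averaged.\<close>

lemma nn_integral_offspring_env:
  assumes f [measurable]: "f \<in> borel_measurable (offspring_space \<Otimes>\<^sub>M env_space)"
  shows "(\<integral>\<^sup>+\<omega>. f (offspring_numbers \<omega>, \<lambda>n. \<xi> n \<omega>) \<partial>M)
    = (\<integral>\<^sup>+\<omega>. (\<integral>\<^sup>+\<nu>. f (\<nu>, \<lambda>n. \<xi> n \<omega>) \<partial>quenched_law p (\<lambda>n. \<xi> n \<omega>)) \<partial>M)"
proof -
  note [measurable] = measurable_quenched_law
  let ?S = "offspring_space \<Otimes>\<^sub>M env_space"
  let ?\<tau> = "distr M env_space (\<lambda>\<omega> n. \<xi> n \<omega>)"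
  let ?K = "\<lambda>x. distr (quenched_law p x) ?S (\<lambda>\<nu>. (\<nu>, x))"
  have K: "?K \<in> env_space \<rightarrow>\<^sub>M prob_algebra ?S"
    by measurable
  have K_int: "(\<integral>\<^sup>+y. f y \<partial>?K x) = (\<integral>\<^sup>+\<nu>. f (\<nu>, x) \<partial>quenched_law p x)" if "x \<in> space env_space" for x
    using that by (intro nn_integral_distr) (auto simp: sets_quenched_law cong: measurable_cong_sets)
  have "(\<integral>\<^sup>+\<omega>. f (offspring_numbers \<omega>, \<lambda>n. \<xi> n \<omega>) \<partial>M) = (\<integral>\<^sup>+y. f y \<partial>(?\<tau> \<bind> ?K))"
    unfolding distr_offspring_env[symmetric] by (simp add: nn_integral_distr)
  also have "\<dots> = (\<integral>\<^sup>+x. (\<integral>\<^sup>+y. f y \<partial>?K x) \<partial>?\<tau>)"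
    using measurable_prob_algebraD[OF K]
    by (intro nn_integral_bind[where B = ?S]) (auto cong: measurable_cong_sets)
  also have "\<dots> = (\<integral>\<^sup>+\<omega>. (\<integral>\<^sup>+y. f y \<partial>?K (\<lambda>n. \<xi> n \<omega>)) \<partial>M)"
    using measurable_prob_algebraD[OF K] by (subst nn_integral_distr) auto
  also have "\<dots> = (\<integral>\<^sup>+\<omega>. (\<integral>\<^sup>+\<nu>. f (\<nu>, \<lambda>n. \<xi> n \<omega>) \<partial>quenched_law p (\<lambda>n. \<xi> n \<omega>)) \<partial>M)"
    using measurable_space[OF measurable_env] by (intro nn_integral_cong K_int)
  finally show ?thesis .
qed

section \<open>Annealed bound and tail of the normalised population ratio\<close>

lemma nn_integral_normalized_population_ratio_le:
  "(\<integral>\<^sup>+\<omega>. ennreal (population N (j + n) \<omega> / population N j \<omega>)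
      * (\<Prod>k\<in>{j..<j + n}. inverse (offspring_mean (p (\<xi> k \<omega>)))) \<partial>M) \<le> 1"
proof -
  let ?Z = "coordinate_population"
  define f where "f = (\<lambda>(\<nu>, x). ennreal (?Z (j + n) \<nu> / ?Z j \<nu>)
    * (\<Prod>k\<in>{j..<j + n}. inverse (offspring_mean (p (x k)))))"
  have A: "{..<k} \<times> {1..} \<subseteq> individuals" for k by (auto simp: individuals_def)
  note [measurable] = measurable_coordinate_population[OF A order.refl]
  have f [measurable]: "f \<in> borel_measurable (offspring_space \<Otimes>\<^sub>M env_space)"
    unfolding f_def by measurable
  have "(\<integral>\<^sup>+\<nu>. f (\<nu>, x) \<partial>quenched_law p x) \<le> 1" for x
  proof -
    have "(\<integral>\<^sup>+\<nu>. f (\<nu>, x) \<partial>quenched_law p x)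
        = (\<integral>\<^sup>+\<nu>. ennreal (?Z (j + n) \<nu> / ?Z j \<nu>) \<partial>quenched_law p x)
          * (\<Prod>k\<in>{j..<j + n}. inverse (offspring_mean (p (x k))))"
      unfolding f_def prod.case
      by (intro nn_integral_multc) (simp add: sets_quenched_law cong: measurable_cong_sets)
    also have "\<dots> \<le> (\<Prod>k\<in>{j..<j + n}. offspring_mean (p (x k)))
        * (\<Prod>k\<in>{j..<j + n}. inverse (offspring_mean (p (x k))))"
      by (intro mult_right_mono nn_integral_quenched_population_ratio_le) simp
    also have "\<dots> = (\<Prod>k\<in>{j..<j + n}. offspring_mean (p (x k)) * inverse (offspring_mean (p (x k))))"
      by (simp add: prod.distrib)
    also have "\<dots> \<le> (\<Prod>k\<in>{j..<j + n}. 1)"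
    proof (rule prod_mono_ennreal)
      \<comment> \<open>In [0,\<infinity>] the product is 0 for m = 0 and m = \<infinity>, and 1
        otherwise; the bound thus needs no finiteness of the means.\<close>
      show "m * inverse m \<le> 1" for m :: ennreal
        by (cases "m = 0 \<or> m = \<top>") (auto simp: less_top simp flip: divide_ennreal_def)
    qed
    finally show ?thesis by simp
  qed
  then have "(\<integral>\<^sup>+\<omega>. f (offspring_numbers \<omega>, \<lambda>n. \<xi> n \<omega>) \<partial>M) \<le> (\<integral>\<^sup>+\<omega>. 1 \<partial>M)"
    unfolding nn_integral_offspring_env[OF f] by (intro nn_integral_mono) simp
  then show ?thesis
    by (simp add: f_def emeasure_space_1 flip: population_eq_coordinate_population)
qed

lemma measurable_population [measurable]: "population N n \<in> M \<rightarrow>\<^sub>M count_space UNIV"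
proof -
  have "{..<n} \<times> {1..} \<subseteq> individuals" by (auto simp: individuals_def)
  from measurable_compose[OF measurable_offspring_numbers measurable_coordinate_population[OF this order.refl]]
  show ?thesis by (simp flip: population_eq_coordinate_population)
qed

lemma AE_env_iff:
  assumes P: "{e \<in> space E. P e} \<in> sets E"
  shows "(AE \<omega> in M. P (\<xi> n \<omega>)) \<longleftrightarrow> (AE \<omega> in M. P (\<xi> 0 \<omega>))"
  using AE_distr_iff[OF random_variable_env P, of n] AE_distr_iff[OF random_variable_env P, of 0]
  unfolding identical_env[of n] by simp

lemma nn_integral_env_eq:
  assumes f: "f \<in> borel_measurable E"
  shows "(\<integral>\<^sup>+\<omega>. f (\<xi> n \<omega>) \<partial>M) = (\<integral>\<^sup>+\<omega>. f (\<xi> 0 \<omega>) \<partial>M)"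
proof -
  have "(\<integral>\<^sup>+\<omega>. f (\<xi> k \<omega>) \<partial>M) = (\<integral>\<^sup>+e. f e \<partial>distr M E (\<xi> k))" for k
    using f by (intro nn_integral_distr[symmetric] random_variable_env) simp
  then show ?thesis
    using identical_env[of n] by simp
qed

lemma prob_normalized_population_ratio_le:
  assumes "c \<ge> 0"
  shows "prob {\<omega> \<in> space M. 1 \<le> ennreal c * (ennreal (population N (j + n) \<omega> / population N j \<omega>)
      * (\<Prod>k\<in>{j..<j + n}. inverse (offspring_mean (p (\<xi> k \<omega>)))))} \<le> c" (is "prob ?S \<le> c")
proof -
  note [measurable] = random_variable_env
  have "emeasure M ?S \<le> ennreal c * (\<integral>\<^sup>+\<omega>. ennreal (population N (j + n) \<omega> / population N j \<omega>)
      * (\<Prod>k\<in>{j..<j + n}. inverse (offspring_mean (p (\<xi> k \<omega>)))) \<partial>M)"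
    by (intro nn_integral_Markov_inequality_space) measurable
  also have "\<dots> \<le> ennreal c"
    using mult_left_mono[OF nn_integral_normalized_population_ratio_le, of "ennreal c"] by simp
  finally show ?thesis
    using assms by (simp add: emeasure_eq_measure)
qed

end

section \<open>The confidence bound from the two tail estimates\<close>

theorem proposition3p1:
  fixes M :: "'a measure"
    and E :: "'e measure"
    and p :: "'e \<Rightarrow> nat pmf"
    and \<xi> :: "nat \<Rightarrow> 'a \<Rightarrow> 'e"
    and N :: "nat \<Rightarrow> nat \<Rightarrow> 'a \<Rightarrow> nat"
    and Z :: "nat \<Rightarrow> 'a \<Rightarrow> nat"
    and X :: "'a \<Rightarrow> real"
    and A :: "'a \<Rightarrow> real"
    and \<mu> \<sigma> H \<delta> \<Delta> :: real
    and n\<^sub>0 n :: nat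
  assumes bpre: "branching_process_random_env M E p \<xi> N"
    and Z_eq: "Z = population N"
    and mean_finite: "AE \<omega> in M. offspring_mean (p (\<xi> 0 \<omega>)) < \<top>"
    and X_eq: "X = (\<lambda>\<omega>. ln (enn2real (offspring_mean (p (\<xi> 0 \<omega>)))))"
    and \<mu>_eq: "\<mu> = integral\<^sup>L M X"
    and \<sigma>_eq: "\<sigma>\<^sup>2 = (LINT \<omega>|M. (X \<omega> - \<mu>)\<^sup>2)"
    and no_extinction: "AE \<omega> in M. pmf (p (\<xi> 0 \<omega>)) 0 = 0"
    and X_integrable: "integrable M X"
    and \<sigma>_finite: "integrable M (\<lambda>\<omega>. (X \<omega> - \<mu>)\<^sup>2)"
    and \<sigma>_pos: "0 < \<sigma>"
    and H_pos: "0 < H"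
    and moments_finite: "\<And>k. k \<ge> 3 \<Longrightarrow> integrable M (\<lambda>\<omega>. (X \<omega> - \<mu>) ^ k)"
    and bernstein: "\<And>k. k \<ge> 3 \<Longrightarrow>
      (LINT \<omega>|M. (X \<omega> - \<mu>) ^ k) \<le> 1 / 2 * fact k * H ^ (k - 2) * (LINT \<omega>|M. (X \<omega> - \<mu>)\<^sup>2)"
    and n_pos: "1 \<le> n"
    and \<delta>_range: "0 < \<delta>" "\<delta> < 1"
    and \<Delta>_eq: "\<Delta> = 6 * (1 + H) / real n * ln (2 / \<delta>)
      + sqrt (36 * (1 + H)\<^sup>2 / (real n)\<^sup>2 * (ln (2 / \<delta>))\<^sup>2 + 2 / real n * \<sigma>\<^sup>2 * ln (2 / \<delta>))"
    and A_eq: "A = (\<lambda>\<omega>. 1 / real n * ln (real (Z (n\<^sub>0 + n) \<omega>) / real (Z n\<^sub>0 \<omega>)) - \<Delta>)"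
  shows "measure M {\<omega> \<in> space M. \<mu> \<in> {A \<omega>..}} \<ge> 1 - \<delta>"
proof -
  interpret branching_process_random_env M E p \<xi> N by (rule bpre)
  note [measurable] = random_variable_env measurable_offspring_law
  define g where "g e = ln (enn2real (offspring_mean (p e)))" for e
  have [measurable]: "g \<in> borel_measurable E"
    unfolding g_def by measurable
  define Y where "Y k \<omega> = g (\<xi> k \<omega>) - \<mu>" for k \<omega>
  have Y_0: "Y 0 = (\<lambda>\<omega>. X \<omega> - \<mu>)"
    by (simp add: Y_def g_def X_eq fun_eq_iff)
  have Y_indep: "indep_vars (\<lambda>_. borel) Y UNIV"
    unfolding Y_def by (rule indep_vars_compose2[OF indep_env]) measurable
  define I where "I = {n\<^sub>0..<n\<^sub>0 + n}"
  define L where "L = ln (2 / \<delta>)"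
  define a where "a = L / n"
  \<comment> \<open>This is the nonnegative root of x^2 = 2 a (\<sigma>^2 + H x), so the Bernstein
    exponent n x^2 / (2 (\<sigma>^2 + H x)) equals L = ln(2/\<delta>) and the tail is
    \<delta>/2.\<close>
  define x where "x = H * a + sqrt ((H * a)\<^sup>2 + 2 * \<sigma>\<^sup>2 * a)"
  have n: "real n > 0" and L: "L > 0"
    using n_pos \<delta>_range by (simp_all add: L_def)
  then have a: "a > 0" by (simp add: a_def)
  have rad: "(H * a)\<^sup>2 + 2 * \<sigma>\<^sup>2 * a \<ge> 0"
    using a by simp
  have x: "x \<ge> 0"
    using a H_pos by (simp add: x_def)
  have x_sq: "x\<^sup>2 = 2 * a * (\<sigma>\<^sup>2 + H * x)"
  proof -
    have "(x - H * a)\<^sup>2 = (H * a)\<^sup>2 + 2 * \<sigma>\<^sup>2 * a"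
      using rad by (simp only: x_def add_diff_cancel_left' real_sqrt_pow2)
    then show ?thesis
      by (simp add: power2_diff algebra_simps)
  qed
  \<comment> \<open>With a = L/n, \<Delta> has the shape of x with 6(1+H) in place of H. The linear
    term also absorbs the extra a, which pays for the Markov estimate.\<close>
  have \<Delta>_ge: "x + a \<le> \<Delta>"
  proof -
    have \<Delta>_a: "\<Delta> = 6 * (1 + H) * a + sqrt ((6 * (1 + H) * a)\<^sup>2 + 2 * \<sigma>\<^sup>2 * a)"
    proof -
      have sq: "(6 * (1 + H) * a)\<^sup>2 = 36 * (1 + H)\<^sup>2 / (real n)\<^sup>2 * L\<^sup>2"
        unfolding a_def by (simp only: power_mult_distrib power_divide) simp
      show ?thesis
        unfolding sq by (simp add: \<Delta>_eq L_def a_def)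
    qed
    have "(H * a)\<^sup>2 \<le> (6 * (1 + H) * a)\<^sup>2"
      using a H_pos by (intro power_mono mult_right_mono) auto
    then have "sqrt ((H * a)\<^sup>2 + 2 * \<sigma>\<^sup>2 * a) \<le> sqrt ((6 * (1 + H) * a)\<^sup>2 + 2 * \<sigma>\<^sup>2 * a)"
      by simp
    moreover have "H * a + a \<le> 6 * (1 + H) * a"
      using a H_pos mult_pos_pos[of H a] by (simp add: algebra_simps)
    ultimately show ?thesis
      unfolding x_def \<Delta>_a by linarith
  qed

  have moment: "(\<integral>\<^sup>+\<omega>. exp (t * Y k \<omega>) \<partial>M) \<le> exp (t\<^sup>2 * \<sigma>\<^sup>2 / (2 * (1 - t * H)))"
    if t: "0 \<le> t" "t * H < 1" for k t
  proof -
    have "integrable M (\<lambda>\<omega>. (X \<omega> - \<mu>) ^ k)" for k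
    proof -
      consider "k = 0" | "k = 1" | "k = 2" | "k \<ge> 3" by linarith
      then show ?thesis
        using X_integrable \<sigma>_finite moments_finite by cases auto
    qed
    moreover have "expectation (\<lambda>\<omega>. X \<omega> - \<mu>) = 0"
      using X_integrable by (simp add: \<mu>_eq prob_space)
    ultimately have "(\<integral>\<^sup>+\<omega>. exp (t * (X \<omega> - \<mu>)) \<partial>M) \<le> exp (t\<^sup>2 * \<sigma>\<^sup>2 / (2 * (1 - t * H)))"
      unfolding \<sigma>_eq using bernstein H_pos t by (intro bernstein_exponential_moment) auto
    moreover have "(\<integral>\<^sup>+\<omega>. exp (t * Y k \<omega>) \<partial>M) = (\<integral>\<^sup>+\<omega>. exp (t * Y 0 \<omega>) \<partial>M)"
      unfolding Y_def by (rule nn_integral_env_eq) measurable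
    ultimately show ?thesis
      by (simp add: Y_0)
  qed
  define S where "S = {\<omega> \<in> space M. n * x \<le> (\<Sum>k\<in>I. Y k \<omega>)}"
  have "prob S \<le> exp (- (n * x\<^sup>2 / (2 * (\<sigma>\<^sup>2 + H * x))))"
  proof -
    have card: "card I = n" by (simp add: I_def)
    show ?thesis
      unfolding S_def card[symmetric]
      by (rule bernstein_tail[OF _ indep_vars_subset[OF Y_indep] moment])
        (use \<sigma>_pos H_pos x in \<open>auto simp: I_def\<close>)
  qed
  also have "n * x\<^sup>2 / (2 * (\<sigma>\<^sup>2 + H * x)) = L"
  proof -
    have "n * (2 * a * d) / (2 * d) = L" if "d > 0" for d
      using that n by (simp add: a_def)
    moreover have "\<sigma>\<^sup>2 + H * x > 0"
      using \<sigma>_pos H_pos x by (simp add: add_pos_nonneg)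
    ultimately show ?thesis
      unfolding x_sq .
  qed
  also have "exp (- L) = \<delta> / 2"
    using \<delta>_range by (simp add: L_def exp_minus)
  finally have prob_S: "prob S \<le> \<delta> / 2" .

  define r where "r \<omega> = real (Z (n\<^sub>0 + n) \<omega>) / real (Z n\<^sub>0 \<omega>)" for \<omega>
  define m where "m k \<omega> = offspring_mean (p (\<xi> k \<omega>))" for k \<omega>
  \<comment> \<open>On \<open>W\<close> the normalised ratio is at least 2/\<delta>, written
    multiplicatively to suit Markov's inequality.\<close>
  define W where "W = {\<omega> \<in> space M. 1 \<le> ennreal (\<delta> / 2) * (ennreal (r \<omega>) * (\<Prod>k\<in>I. inverse (m k \<omega>)))}"
  have prob_W: "prob W \<le> \<delta> / 2"
    unfolding W_def r_def m_def I_def Z_eq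
    using \<delta>_range by (intro prob_normalized_population_ratio_le) simp
  have [measurable]: "r \<in> borel_measurable M" "\<And>k. m k \<in> borel_measurable M"
    "\<And>k. Y k \<in> borel_measurable M"
    unfolding r_def m_def Y_def Z_eq by measurable
  have [measurable]: "S \<in> events" "W \<in> events"
    unfolding S_def W_def by measurable
  have A_r: "A \<omega> = ln (r \<omega>) / n - \<Delta>" for \<omega>
    by (simp add: A_eq r_def)
  have [measurable]: "A \<in> borel_measurable M"
    unfolding A_r[abs_def] by measurable

  have "AE \<omega> in M. m k \<omega> < \<top>" for k
    using mean_finite unfolding m_def by (subst AE_env_iff) auto
  then have mean_lt_top: "AE \<omega> in M. \<forall>k. m k \<omega> < \<top>"
    by (simp add: AE_all_countable)
  have "AE \<omega> in M. pmf (p (\<xi> k \<omega>)) 0 = 0" for k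
    using no_extinction by (subst AE_env_iff) auto
  then have "AE \<omega> in M. \<forall>k. pmf (p (\<xi> k \<omega>)) 0 = 0"
    by (simp add: AE_all_countable)
  then have mean_ge_1: "AE \<omega> in M. \<forall>k. 1 \<le> m k \<omega>"
    by eventually_elim (simp add: m_def offspring_mean_ge_1)
  have real_mean: "1 \<le> enn2real b" "b = ennreal (enn2real b)" if "1 \<le> b" "b < \<top>" for b
    using that by (cases b; simp)+
  \<comment> \<open>All means are almost surely finite and at least 1, so their logarithms are
    nonnegative.\<close>
  have \<mu>_nonneg: "\<mu> \<ge> 0"
    unfolding \<mu>_eq
  proof (rule integral_nonneg_AE)
    show "AE \<omega> in M. 0 \<le> X \<omega>"
      using mean_lt_top mean_ge_1
      by eventually_elim (use real_mean in \<open>auto simp: X_eq m_def\<close>)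
  qed

  \<comment> \<open>If the bound fails, ln r > n\<mu> + nx + L. Off \<open>S\<close> the logarithms
    of the means sum to less than n\<mu> + nx, so the logarithm of the normalised ratio exceeds L,
    which is membership in \<open>W\<close>.\<close>
  have "AE \<omega> in M. \<omega> \<in> {\<omega> \<in> space M. \<mu> < A \<omega>} \<longrightarrow> \<omega> \<in> S \<union> W"
    using mean_lt_top mean_ge_1
  proof eventually_elim
    case (elim \<omega>)
    define b where "b k = enn2real (m k \<omega>)" for k
    have b: "1 \<le> b k" "m k \<omega> = ennreal (b k)" for k
      unfolding b_def using real_mean elim by blast+
    have b_pos: "0 < b k" for k
      using b(1)[of k] by linarith
    have "\<omega> \<in> W" if \<omega>: "\<omega> \<in> space M" "\<mu> < A \<omega>" "\<omega> \<notin> S"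
    proof -
      have "n * (\<mu> + \<Delta>) < ln (r \<omega>)"
        using \<omega>(2) n by (simp add: A_r field_simps)
      moreover have "n * (\<mu> + (x + a)) \<le> n * (\<mu> + \<Delta>)"
        using \<Delta>_ge n by (intro mult_left_mono) auto
      ultimately have ln_r: "n * \<mu> + n * x + L < ln (r \<omega>)"
        using n by (simp add: a_def algebra_simps)
      \<comment> \<open>As \<open>ln 0 = 0\<close> and \<open>x / 0 = 0\<close>, a vanishing population must be excluded by \<open>\<mu> \<ge> 0\<close>.\<close>
      have r_pos: "r \<omega> > 0"
      proof (rule ccontr)
        assume "\<not> r \<omega> > 0"
        moreover have "r \<omega> \<ge> 0"
          by (simp add: r_def)
        ultimately have "r \<omega> = 0"
          by linarith
        moreover have "0 \<le> n * \<mu> + n * x + L"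
          using \<mu>_nonneg n x L by simp
        ultimately show False
          using ln_r by simp
      qed
      have "(\<Sum>k\<in>I. ln (b k)) - n * \<mu> < n * x"
        using \<omega> by (simp add: S_def Y_def g_def b_def m_def sum_subtractf I_def)
      moreover have "ln (\<Prod>k\<in>I. b k) = (\<Sum>k\<in>I. ln (b k))"
        using b_pos by (intro ln_prod) (auto simp: I_def less_le)
      ultimately have "ln (\<Prod>k\<in>I. b k) + ln (2 / \<delta>) < ln (r \<omega>)"
        using ln_r by (simp add: L_def)
      moreover have P: "(\<Prod>k\<in>I. b k) > 0"
        using b_pos by (simp add: prod_pos)
      ultimately have "ln ((\<Prod>k\<in>I. b k) * (2 / \<delta>)) < ln (r \<omega>)"
        using \<delta>_range by (subst ln_mult) auto
      then have "(\<Prod>k\<in>I. b k) * (2 / \<delta>) < r \<omega>"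
        using P r_pos \<delta>_range by (subst (asm) ln_less_cancel_iff) auto
      then have "1 \<le> \<delta> / 2 * (r \<omega> * inverse (\<Prod>k\<in>I. b k))"
        using P \<delta>_range by (simp add: field_simps)
      moreover have "(\<Prod>k\<in>I. inverse (m k \<omega>)) = ennreal (inverse (\<Prod>k\<in>I. b k))"
        using b_pos by (simp add: b(2) inverse_ennreal prod_ennreal less_imp_le prod_inversef[symmetric])
      ultimately show "\<omega> \<in> W"
        using \<omega>(1) r_pos \<delta>_range P by (simp add: W_def ennreal_mult'[symmetric] less_imp_le)
    qed
    then show ?case by auto
  qed
  then have "prob {\<omega> \<in> space M. \<mu> < A \<omega>} \<le> prob (S \<union> W)"
    by (intro finite_measure_mono_AE) measurable
  also have "\<dots> \<le> prob S + prob W"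
    by (intro measure_Un_le) measurable
  also have "\<dots> \<le> \<delta>"
    using prob_S prob_W by simp
  finally have "prob {\<omega> \<in> space M. \<mu> < A \<omega>} \<le> \<delta>" .
  moreover have "{\<omega> \<in> space M. \<mu> \<in> {A \<omega>..}} = space M - {\<omega> \<in> space M. \<mu> < A \<omega>}"
    by auto
  moreover have "prob (space M - {\<omega> \<in> space M. \<mu> < A \<omega>}) = 1 - prob {\<omega> \<in> space M. \<mu> < A \<omega>}"
    by (rule prob_compl) measurable
  ultimately show ?thesis
    by simp
qed

end
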